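(* Let $\tilde\mu\in\tilde{\mathfrak{H}}_{V,1}$ be any $V$-variable fractal measure and let $\epsilon>0$. Then $\tilde\mu$ is a finite weighted superposition of continuous transformations of at most $V$ distinct normalized measures supported on compact subsets of $\mathbb{X}$, and the diameter of the support of each of these transformed measures is at most $\epsilon$. (That is, there are Borel probability measures $\varpi_1,\dots,\varpi_V$ on $\mathbb{X}$, finitely many continuous maps $g_1,\dots,g_r:\mathbb{X}\to\mathbb{X}$, weights $w_1,\dots,w_r\ge0$ and indices $v(1),\dots,v(r)\in\{1,\dots,V\}$ such that $\tilde\mu=\sum_{j=1}^r w_j\,g_j(\varpi_{v(j)})$ and the support of each $g_j(\varpi_{v(j)})$ has diameter at most $\epsilon$.)
   Context: SuperIFS. $(\mathbb{X},d)$ is a compact metric space; $M,N,V$ are positive integers. For $n\in\{1,\dots,N\}$, $m\in\{1,\dots,M\}$, $f_m^n:\mathbb{X}\to\mathbb{X}$ is Lipschitz with constant $l$, where $0\le l<1$ is fixed, and $p_m^n\ge0$ with $\sum_{m=1}^Mp_m^n=1$ for each $n$. $\mathbb{P}=\mathbb{P}(\mathbb{X})$ is the set of Borel probability measures on $\mathbb{X}$ with the Monge–Kantorovitch metric $d(\mu,\nu)=\sup\{\int f\,d\mu-\int f\,d\nu\}$ over $f:\mathbb{X}\to\mathbb{R}$ with Lipschitz constant at most $1$; $\mathbb{P}^V$ carries the maximum metric. For $f:\mathbb{X}\to\mathbb{X}$ continuous and $\mu\in\mathbb{P}$, $f(\mu)=\mu\circ f^{-1}$. $\mathcal{A}=\{\{1,\dots,N\}\times\{1,\dots,V\}^M\}^V$;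 write $a=(a_1,\dots,a_V)\in\mathcal{A}$ with $a_v=(n_v;v_{v,1},\dots,v_{v,M})$. For $a\in\mathcal{A}$ define $f^a:\mathbb{P}^V\to\mathbb{P}^V$ by letting the $v$-th component of $f^a(\mu_1,\dots,\mu_V)$ be $\sum_{m=1}^M p_m^{n_v}f_m^{n_v}(\mu_{v_{v,m}})$; each $f^a$ is a contraction. $\tilde{\mathfrak{H}}_V\subset\mathbb{P}^V$ is the set attractor of the IFS $\{\mathbb{P}^V;f^a,a\in\mathcal{A}\}$, i.e. the unique non-empty compact subset of $\mathbb{P}^V$ with $\tilde{\mathfrak{H}}_V=\bigcup_{a\in\mathcal{A}}f^a(\tilde{\mathfrak{H}}_V)$. $\tilde{\mathfrak{H}}_{V,1}\subset\mathbb{P}$ is the set of first components of elements of $\tilde{\mathfrak{H}}_V$; its elements are called $V$-variable fractal measures. *)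

theory Defs
  imports "HOL-Probability.Probability"
begin

definition borel_probs :: "'a::topological_space measure set" where
  "borel_probs = {\<mu>. sets \<mu> = sets borel \<and> prob_space \<mu>}"

(* The locale Metric_space demands non-negativity and symmetry of the distance function on the
   whole type, hence the value 0 outside borel_probs. *)
definition MK_dist :: "'a::metric_space measure \<Rightarrow> 'a measure \<Rightarrow> real" where
  "MK_dist \<mu> \<nu> =
     (if \<mu> \<in> borel_probs \<and> \<nu> \<in> borel_probs
      then (SUP f\<in>{f :: 'a \<Rightarrow> real. 1-lipschitz_on UNIV f}. (\<integral>x. f x \<partial>\<mu>) - (\<integral>x. f x \<partial>\<nu>))
      else 0)"

(* V-tuples are functions on nat that are undefined outside {1..V}. *)
definition prob_tuples :: "nat \<Rightarrow> (nat \<Rightarrow> 'a::topological_space measure) set" where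
  "prob_tuples V = ({1..V} \<rightarrow>\<^sub>E borel_probs)"

definition MK_dist_max ::
    "nat \<Rightarrow> (nat \<Rightarrow> 'a::metric_space measure) \<Rightarrow> (nat \<Rightarrow> 'a measure) \<Rightarrow> real" where
  "MK_dist_max V \<mu> \<nu> = Max ((\<lambda>v. MK_dist (\<mu> v) (\<nu> v)) ` {1..V})"

definition weighted_sum ::
    "'i set \<Rightarrow> ('i \<Rightarrow> real) \<Rightarrow> ('i \<Rightarrow> 'a::topological_space measure) \<Rightarrow> 'a measure" where
  "weighted_sum I w \<mu> =
     measure_of UNIV (sets borel) (\<lambda>A. \<Sum>i\<in>I. ennreal (w i) * emeasure (\<mu> i) A)"

(* An index a assigns to each v the pair of n_v and the map sending m to v_{v,m}. *)
definition superIFS_indices :: "nat \<Rightarrow> nat \<Rightarrow> nat \<Rightarrow> (nat \<Rightarrow> nat \<times> (nat \<Rightarrow> nat)) set" where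
  "superIFS_indices M N V = ({1..V} \<rightarrow>\<^sub>E {1..N} \<times> ({1..M} \<rightarrow>\<^sub>E {1..V}))"

(* f n m and p n m are the m-th map and the m-th weight of the n-th IFS. *)
definition superIFS_map ::
    "nat \<Rightarrow> nat \<Rightarrow> (nat \<Rightarrow> nat \<Rightarrow> 'a \<Rightarrow> 'a::topological_space) \<Rightarrow> (nat \<Rightarrow> nat \<Rightarrow> real)
     \<Rightarrow> (nat \<Rightarrow> nat \<times> (nat \<Rightarrow> nat)) \<Rightarrow> (nat \<Rightarrow> 'a measure) \<Rightarrow> (nat \<Rightarrow> 'a measure)" where
  "superIFS_map M V f p a \<mu> =
     (\<lambda>v\<in>{1..V}. weighted_sum {1..M} (p (fst (a v)))
        (\<lambda>m. distr (\<mu> (snd (a v) m)) borel (f (fst (a v)) m)))"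

(* If the maps in F are contractions of a complete non-empty metric space (X, d) and F is finite and
   non-empty, there is exactly one such set H. *)
definition is_set_attractor ::
    "'b set \<Rightarrow> ('b \<Rightarrow> 'b \<Rightarrow> real) \<Rightarrow> ('b \<Rightarrow> 'b) set \<Rightarrow> 'b set \<Rightarrow> bool" where
  "is_set_attractor X d F H \<longleftrightarrow>
     H \<noteq> {} \<and> H \<subseteq> X \<and> compactin (Metric_space.mtopology X d) H \<and> H = (\<Union>\<phi>\<in>F. \<phi> ` H)"

definition measure_support :: "'a::topological_space measure \<Rightarrow> 'a set" where
  "measure_support \<mu> = {x. \<forall>U. open U \<and> x \<in> U \<longrightarrow> emeasure \<mu> U > 0}"

lemma emeasure_weighted_sum:
  assumes "finite I" "\<And>i. i \<in> I \<Longrightarrow> sets (\<mu> i) = sets borel" "A \<in> sets borel"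
  shows "emeasure (weighted_sum I w \<mu>) A = (\<Sum>i\<in>I. ennreal (w i) * emeasure (\<mu> i) A)"
proof (rule emeasure_measure_of[OF weighted_sum_def])
  show "countably_additive (sets (weighted_sum I w \<mu>)) (\<lambda>A. \<Sum>i\<in>I. ennreal (w i) * emeasure (\<mu> i) A)"
  proof (rule countably_additiveI)
    fix B :: "nat \<Rightarrow> 'b set"
    assume B: "range B \<subseteq> sets (weighted_sum I w \<mu>)" "disjoint_family B"
    have sets: "sets (weighted_sum I w \<mu>) = sets borel"
      using sets.sigma_sets_eq[of borel] by (simp add: weighted_sum_def)
    have "(\<Sum>k. \<Sum>i\<in>I. ennreal (w i) * emeasure (\<mu> i) (B k))
        = (\<Sum>i\<in>I. \<Sum>k. ennreal (w i) * emeasure (\<mu> i) (B k))"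
      by (rule suminf_sum) simp
    also have "\<dots> = (\<Sum>i\<in>I. ennreal (w i) * emeasure (\<mu> i) (\<Union>k. B k))"
      using B assms(2) sets by (intro sum.cong refl) (simp add: suminf_emeasure)
    finally show "(\<Sum>k. \<Sum>i\<in>I. ennreal (w i) * emeasure (\<mu> i) (B k))
        = (\<Sum>i\<in>I. ennreal (w i) * emeasure (\<mu> i) (\<Union>k. B k))" .
  qed
qed (use assms sets.sigma_sets_eq[of borel] in \<open>auto simp: positive_def weighted_sum_def\<close>)

lemma integrable_borel_probs:
  fixes f :: "'a::metric_space \<Rightarrow> real"
  assumes "compact (UNIV :: 'a set)" "\<mu> \<in> borel_probs" "continuous_on UNIV f"
  shows "integrable \<mu> f"
proof -
  interpret prob_space \<mu> using assms(2) by (simp add: borel_probs_def)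
  have s: "sets \<mu> = sets borel" using assms(2) by (simp add: borel_probs_def)
  have "bounded (range f)"
    using assms by (intro compact_imp_bounded compact_continuous_image)
  then obtain B where "\<And>x. norm (f x) \<le> B" by (auto simp: bounded_iff)
  moreover have "f \<in> borel_measurable \<mu>"
    using borel_measurable_continuous_onI[OF assms(3)] measurable_cong_sets[OF s refl] by blast
  ultimately show ?thesis by (intro integrable_const_bound[where B=B]) auto
qed

lemma MK_dist_bound:
  fixes f :: "'a::metric_space \<Rightarrow> real"
  assumes "compact (UNIV :: 'a set)" "\<mu> \<in> borel_probs" "\<nu> \<in> borel_probs" "1-lipschitz_on UNIV f"
  shows "(\<integral>x. f x \<partial>\<mu>) - (\<integral>x. f x \<partial>\<nu>) \<le> diameter (UNIV :: 'a set)"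
proof -
  interpret m: prob_space \<mu> using assms(2) by (simp add: borel_probs_def)
  interpret n: prob_space \<nu> using assms(3) by (simp add: borel_probs_def)
  define D where "D = diameter (UNIV :: 'a set)"
  obtain x0 :: 'a where True by simp
  have cf: "continuous_on UNIV f" using assms(4) by (rule lipschitz_on_continuous_on)
  have b: "f x - f y \<le> D" for x y
  proof -
    have "\<bar>f x - f y\<bar> \<le> dist x y"
      using lipschitz_onD[OF assms(4), of x y] by (simp add: dist_real_def)
    moreover have "dist x y \<le> D"
      unfolding D_def using assms(1) by (intro diameter_bounded_bound compact_imp_bounded) auto
    ultimately show ?thesis by linarith
  qed
  have i: "integrable \<mu> f" "integrable \<nu> f" using assms cf integrable_borel_probs by auto
  have "(\<integral>x. f x \<partial>\<mu>) \<le> f y + D" for y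
    using m.integral_le_const[OF i(1), of "f y + D"] b[of _ y] by (auto simp: algebra_simps)
  then have "(\<integral>x. f x \<partial>\<mu>) - D \<le> (\<integral>x. f x \<partial>\<nu>)"
    by (intro n.integral_ge_const i) (auto simp: algebra_simps)
  then show ?thesis by (simp add: D_def)
qed

lemma borel_probs_eqI:
  fixes \<mu> \<nu> :: "'a::metric_space measure"
  assumes X: "compact (UNIV :: 'a set)" and p: "\<mu> \<in> borel_probs" "\<nu> \<in> borel_probs"
    and eq: "\<And>f :: 'a \<Rightarrow> real. 1-lipschitz_on UNIV f \<Longrightarrow> (\<integral>x. f x \<partial>\<mu>) = (\<integral>x. f x \<partial>\<nu>)"
  shows "\<mu> = \<nu>"
proof -
  interpret m: prob_space \<mu> using p by (simp add: borel_probs_def)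
  interpret n: prob_space \<nu> using p by (simp add: borel_probs_def)
  have s: "sets \<mu> = sets borel" "sets \<nu> = sets borel" using p by (auto simp: borel_probs_def)
  have sp: "space \<mu> = UNIV" "space \<nu> = UNIV" using s[THEN sets_eq_imp_space_eq] by auto
  have closed_eq: "emeasure \<mu> C = emeasure \<nu> C" if C: "closed C" "C \<noteq> {}" for C
  proof -
    define g where "g = (\<lambda>k x. max 0 (1 - real k * infdist x C))"
    have cg: "continuous_on UNIV (g k)" for k
      unfolding g_def by (intro continuous_intros)
    have ig: "(\<integral>x. g k x \<partial>\<mu>) = (\<integral>x. g k x \<partial>\<nu>)" for k
    proof -
      have "1-lipschitz_on UNIV (\<lambda>x. g k x / (real k + 1))"
      proof (rule lipschitz_onI)
        fix x y
        have "\<bar>infdist x C - infdist y C\<bar> \<le> dist x y" by (rule infdist_triangle_abs)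
        then have "real k * \<bar>infdist x C - infdist y C\<bar> \<le> (real k + 1) * dist x y"
          by (intro mult_mono) auto
        moreover have "\<bar>g k x - g k y\<bar> \<le> \<bar>real k * infdist x C - real k * infdist y C\<bar>"
          unfolding g_def by linarith
        moreover have "\<bar>real k * infdist x C - real k * infdist y C\<bar>
            = real k * \<bar>infdist x C - infdist y C\<bar>"
          by (simp add: abs_mult flip: right_diff_distrib)
        ultimately have "\<bar>g k x - g k y\<bar> \<le> (real k + 1) * dist x y" by linarith
        then show "dist (g k x / (real k + 1)) (g k y / (real k + 1)) \<le> 1 * dist x y"
          by (simp add: dist_real_def field_simps flip: diff_divide_distrib)
      qed simp
      from eq[OF this] show ?thesis by (auto simp: add_nonneg_eq_0_iff)
    qed
    have lim: "(\<lambda>k. \<integral>x. g k x \<partial>\<rho>) \<longlonglongrightarrow> measure \<rho> C" if r: "\<rho> \<in> borel_probs" for \<rho>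
    proof -
      interpret r: prob_space \<rho> using r by (simp add: borel_probs_def)
      have sr: "sets \<rho> = sets borel" using r by (simp add: borel_probs_def)
      have mc: "borel_measurable \<rho> = borel_measurable borel" using sr by (rule measurable_cong_sets) simp
      have Cm: "C \<in> sets \<rho>" using C sr by auto
      have "(\<lambda>k. \<integral>x. g k x \<partial>\<rho>) \<longlonglongrightarrow> (\<integral>x. indicator C x \<partial>\<rho>)"
      proof (rule integral_dominated_convergence[where w="\<lambda>_. 1"])
        show "AE x in \<rho>. (\<lambda>k. g k x) \<longlonglongrightarrow> indicator C x"
        proof (rule AE_I2)
          fix x
          show "(\<lambda>k. g k x) \<longlonglongrightarrow> indicator C x"
          proof (cases "x \<in> C")
            case True
            then show ?thesis by (simp add: g_def)
          next
            case False
            then have pos: "infdist x C > 0" using C by (simp add: infdist_pos_not_in_closed)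
            obtain K where K: "real K > 1 / infdist x C" using reals_Archimedean2 by blast
            have "g k x = 0" if "k \<ge> K" for k
            proof -
              have "real k > 1 / infdist x C" using K that by linarith
              then have "real k * infdist x C > 1" using pos by (simp add: field_simps)
              then show ?thesis by (simp add: g_def)
            qed
            then show ?thesis using False
              by (intro tendsto_eventually) (auto simp: eventually_sequentially)
          qed
        qed
        show "AE x in \<rho>. norm (g k x) \<le> 1" for k by (simp add: g_def infdist_nonneg)
        show "g k \<in> borel_measurable \<rho>" for k
          using cg mc borel_measurable_continuous_onI by blast
      qed (use Cm in auto)
      moreover have "(\<integral>x. indicator C x \<partial>\<rho>) = measure \<rho> C"
        using Cm by (simp add: sets.Int_space_eq2)
      ultimately show ?thesis by simp
    qed
    have "measure \<mu> C = measure \<nu> C"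
      using lim[OF p(1)] lim[OF p(2)] ig LIMSEQ_unique by simp
    then show ?thesis by (simp add: m.emeasure_eq_measure n.emeasure_eq_measure)
  qed
  show ?thesis
  proof (rule measure_eqI_generator_eq[where E="Collect closed" and A="\<lambda>_. UNIV" and \<Omega>=UNIV])
    show "Int_stable (Collect closed :: 'a set set)" by (auto simp: Int_stable_def)
    show "emeasure \<mu> C = emeasure \<nu> C" if "C \<in> Collect closed" for C
      using that closed_eq by (cases "C = {}") auto
    show "sets \<mu> = sigma_sets UNIV (Collect closed)" "sets \<nu> = sigma_sets UNIV (Collect closed)"
      using s by (simp_all add: borel_eq_closed)
  qed (auto simp: m.emeasure_eq_measure)
qed

lemma Metric_space_MK_dist:
  assumes X: "compact (UNIV :: 'a::metric_space set)"
  shows "Metric_space (borel_probs :: 'a measure set) MK_dist"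
proof -
  define L where "L = {f :: 'a \<Rightarrow> real. 1-lipschitz_on UNIV f}"
  define J :: "'a measure \<Rightarrow> 'a measure \<Rightarrow> ('a \<Rightarrow> real) \<Rightarrow> real"
    where "J = (\<lambda>\<mu> \<nu> f. (\<integral>x. f x \<partial>\<mu>) - (\<integral>x. f x \<partial>\<nu>))"
  have MK: "MK_dist \<mu> \<nu> = (SUP f\<in>L. J \<mu> \<nu> f)" if "\<mu> \<in> borel_probs" "\<nu> \<in> borel_probs" for \<mu> \<nu>
    using that by (simp add: MK_dist_def L_def J_def)
  have L0: "(\<lambda>_. 0) \<in> L" by (simp add: L_def lipschitz_on_def)
  have Lm: "(\<lambda>x. - f x) \<in> L" if "f \<in> L" for f
    using that by (auto simp: L_def lipschitz_on_def dist_minus)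
  have upper: "J \<mu> \<nu> f \<le> MK_dist \<mu> \<nu>" if "\<mu> \<in> borel_probs" "\<nu> \<in> borel_probs" "f \<in> L" for \<mu> \<nu> f
    unfolding MK[OF that(1,2)]
  proof (rule cSUP_upper[OF that(3)])
    show "bdd_above (J \<mu> \<nu> ` L)"
      using MK_dist_bound[OF X that(1,2)] by (auto simp: bdd_above_def L_def J_def)
  qed
  have le: "MK_dist \<mu> \<nu> \<le> c"
    if "\<mu> \<in> borel_probs" "\<nu> \<in> borel_probs" "\<And>f. f \<in> L \<Longrightarrow> J \<mu> \<nu> f \<le> c" for \<mu> \<nu> c
    unfolding MK[OF that(1,2)] using L0 that(3) by (intro cSUP_least) auto
  have J_minus: "J \<mu> \<nu> (\<lambda>x. - f x) = J \<nu> \<mu> f" for \<mu> \<nu> f by (simp add: J_def)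
  have sym_le: "MK_dist \<mu> \<nu> \<le> MK_dist \<nu> \<mu>"
    if "\<mu> \<in> borel_probs" "\<nu> \<in> borel_probs" for \<mu> \<nu> :: "'a measure"
    using le[OF that] upper[OF that(2,1) Lm] J_minus by metis
  show ?thesis
  proof
    fix \<mu> \<nu> :: "'a measure"
    show "0 \<le> MK_dist \<mu> \<nu>"
    proof (cases "\<mu> \<in> borel_probs \<and> \<nu> \<in> borel_probs")
      case True
      then show ?thesis using upper[OF _ _ L0, of \<mu> \<nu>] by (simp add: J_def)
    qed (auto simp: MK_dist_def)
    show "MK_dist \<mu> \<nu> = MK_dist \<nu> \<mu>"
    proof (cases "\<mu> \<in> borel_probs \<and> \<nu> \<in> borel_probs")
      case True
      then show ?thesis using sym_le by (simp add: antisym)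
    qed (auto simp: MK_dist_def)
  next
    fix \<mu> \<nu> :: "'a measure" assume p: "\<mu> \<in> borel_probs" "\<nu> \<in> borel_probs"
    show "MK_dist \<mu> \<nu> = 0 \<longleftrightarrow> \<mu> = \<nu>"
    proof
      assume 0: "MK_dist \<mu> \<nu> = 0"
      show "\<mu> = \<nu>"
      proof (rule borel_probs_eqI[OF X p])
        fix f :: "'a \<Rightarrow> real" assume "1-lipschitz_on UNIV f"
        then have "f \<in> L" by (simp add: L_def)
        then have "J \<mu> \<nu> f \<le> 0" "J \<mu> \<nu> (\<lambda>x. - f x) \<le> 0" using upper[OF p] Lm 0 by metis+
        then show "(\<integral>x. f x \<partial>\<mu>) = (\<integral>x. f x \<partial>\<nu>)" by (simp add: J_def)
      qed
    next
      assume "\<mu> = \<nu>"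
      then show "MK_dist \<mu> \<nu> = 0"
        using le[OF p, of 0] upper[OF p L0] by (simp add: J_def)
    qed
  next
    fix \<mu> \<nu> \<rho> :: "'a measure"
    assume p: "\<mu> \<in> borel_probs" "\<nu> \<in> borel_probs" "\<rho> \<in> borel_probs"
    show "MK_dist \<mu> \<rho> \<le> MK_dist \<mu> \<nu> + MK_dist \<nu> \<rho>"
    proof (rule le[OF p(1,3)])
      fix f assume f: "f \<in> L"
      have "J \<mu> \<rho> f = J \<mu> \<nu> f + J \<nu> \<rho> f" by (simp add: J_def)
      then show "J \<mu> \<rho> f \<le> MK_dist \<mu> \<nu> + MK_dist \<nu> \<rho>"
        using upper[OF p(1,2) f] upper[OF p(2,3) f] by linarith
    qed
  qed
qed

lemma Metric_space_MK_dist_max: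
  assumes X: "compact (UNIV :: 'a::metric_space set)" and V: "V > 0"
  shows "Metric_space (prob_tuples V :: (nat \<Rightarrow> 'a measure) set) (MK_dist_max V)"
proof -
  interpret MK: Metric_space "borel_probs :: 'a measure set" MK_dist
    using X by (rule Metric_space_MK_dist)
  have ne: "{1..V} \<noteq> {}" using V by simp
  have le: "MK_dist_max V \<mu> \<nu> \<le> c \<longleftrightarrow> (\<forall>v\<in>{1..V}. MK_dist (\<mu> v) (\<nu> v) \<le> c)"
    for \<mu> \<nu> :: "nat \<Rightarrow> 'a measure" and c
    unfolding MK_dist_max_def using ne by (subst Max_le_iff) auto
  then have upper: "MK_dist (\<mu> v) (\<nu> v) \<le> MK_dist_max V \<mu> \<nu>" if "v \<in> {1..V}"
    for \<mu> \<nu> :: "nat \<Rightarrow> 'a measure" and v using that by blast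
  have nonneg: "0 \<le> MK_dist_max V \<mu> \<nu>" for \<mu> \<nu> :: "nat \<Rightarrow> 'a measure"
    using order_trans[OF MK.nonneg upper[of 1 \<mu> \<nu>]] V by simp
  show ?thesis
  proof
    fix \<mu> \<nu> :: "nat \<Rightarrow> 'a measure"
    show "0 \<le> MK_dist_max V \<mu> \<nu>" by (rule nonneg)
    show "MK_dist_max V \<mu> \<nu> = MK_dist_max V \<nu> \<mu>"
      by (simp add: MK_dist_max_def MK.commute)
  next
    fix \<mu> \<nu> :: "nat \<Rightarrow> 'a measure" assume p: "\<mu> \<in> prob_tuples V" "\<nu> \<in> prob_tuples V"
    then have pv: "\<mu> v \<in> borel_probs" "\<nu> v \<in> borel_probs" if "v \<in> {1..V}" for v
      using that unfolding prob_tuples_def by (meson PiE_mem)+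
    have "MK_dist_max V \<mu> \<nu> = 0 \<longleftrightarrow> (\<forall>v\<in>{1..V}. MK_dist (\<mu> v) (\<nu> v) \<le> 0)"
      using le[of \<mu> \<nu> 0] nonneg[of \<mu> \<nu>] by auto
    also have "\<dots> \<longleftrightarrow> (\<forall>v\<in>{1..V}. \<mu> v = \<nu> v)"
      using pv MK.zero MK.nonneg by (metis order_antisym order_refl)
    also have "\<dots> \<longleftrightarrow> \<mu> = \<nu>"
      using p unfolding prob_tuples_def by (metis PiE_ext)
    finally show "MK_dist_max V \<mu> \<nu> = 0 \<longleftrightarrow> \<mu> = \<nu>" .
  next
    fix \<mu> \<nu> \<rho> :: "nat \<Rightarrow> 'a measure"
    assume p: "\<mu> \<in> prob_tuples V" "\<nu> \<in> prob_tuples V" "\<rho> \<in> prob_tuples V"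
    have "MK_dist (\<mu> v) (\<rho> v) \<le> MK_dist_max V \<mu> \<nu> + MK_dist_max V \<nu> \<rho>" if v: "v \<in> {1..V}" for v
    proof -
      have "\<mu> v \<in> borel_probs" "\<nu> v \<in> borel_probs" "\<rho> v \<in> borel_probs"
        using p v unfolding prob_tuples_def by (meson PiE_mem)+
      then show ?thesis
        using MK.triangle[of "\<mu> v" "\<nu> v" "\<rho> v"] upper[OF v, of \<mu> \<nu>] upper[OF v, of \<nu> \<rho>] by linarith
    qed
    then show "MK_dist_max V \<mu> \<rho> \<le> MK_dist_max V \<mu> \<nu> + MK_dist_max V \<nu> \<rho>"
      by (simp add: le)
  qed
qed

end

theory Submission
  imports Defs
begin

text \<open>
  Every point of the attractor is of the form \<open>f\<^sup>a(\<nu>)\<close> for another point \<open>\<nu>\<close> of the attractor.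
  Substituting this \<open>k\<close> times exhibits the measure as a superposition of images of the \<open>V\<close>
  components of a single point of the attractor under \<open>k\<close>-fold compositions of the contractions.
  The support of each image lies in the range of an \<open>l^k\<close>-Lipschitz map on a bounded space.
\<close>

lemma sets_weighted_sum [simp]: "sets (weighted_sum I w \<mu>) = sets borel"
  using sets.sigma_sets_eq[of borel] by (simp add: weighted_sum_def)

lemma weighted_sum_reindex:
  assumes "bij_betw h J I"
  shows "weighted_sum I w \<mu> = weighted_sum J (\<lambda>j. w (h j)) (\<lambda>j. \<mu> (h j))"
  unfolding weighted_sum_def
  using sum.reindex_bij_betw[OF assms, of "\<lambda>i. ennreal (w i) * emeasure (\<mu> i) _"] by simp

lemma weighted_sum_singleton:
  assumes "sets (\<mu> i) = sets borel" "w i = 1"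
  shows "weighted_sum {i} w \<mu> = \<mu> i"
proof (rule measure_eqI)
  fix A assume "A \<in> sets (weighted_sum {i} w \<mu>)"
  then show "emeasure (weighted_sum {i} w \<mu>) A = emeasure (\<mu> i) A"
    using assms by (subst emeasure_weighted_sum) auto
qed (use assms in simp)

lemma weighted_sum_cong:
  assumes "\<And>i. i \<in> I \<Longrightarrow> w i = w' i" "\<And>i. i \<in> I \<Longrightarrow> \<mu> i = \<mu>' i"
  shows "weighted_sum I w \<mu> = weighted_sum I w' \<mu>'"
  unfolding weighted_sum_def using assms by (simp cong: sum.cong)

text \<open>Pushing forward is linear in the measure, so it passes through the inner sum, and the
  two nested sums become one sum over pairs. This turns a substitution of one superposition into
  another back into a superposition.\<close>

lemma weighted_sum_distr_weighted_sum:
  fixes g :: "'i \<Rightarrow> 'a::topological_space \<Rightarrow> 'b::topological_space"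
  assumes fin: "finite I" "finite K"
    and sets: "\<And>i k. i \<in> I \<Longrightarrow> k \<in> K \<Longrightarrow> sets (\<nu> i k) = sets borel"
    and g: "\<And>i. i \<in> I \<Longrightarrow> g i \<in> borel_measurable borel"
    and w: "\<And>i. i \<in> I \<Longrightarrow> w i \<ge> 0"
  shows "weighted_sum I w (\<lambda>i. distr (weighted_sum K (q i) (\<nu> i)) borel (g i))
       = weighted_sum (I \<times> K) (\<lambda>(i, k). w i * q i k) (\<lambda>(i, k). distr (\<nu> i k) borel (g i))"
    (is "?L = ?R")
proof (rule measure_eqI)
  fix A assume "A \<in> sets ?L"
  then have A: "A \<in> sets borel" by simp
  have "emeasure ?L A
      = (\<Sum>i\<in>I. ennreal (w i) * emeasure (distr (weighted_sum K (q i) (\<nu> i)) borel (g i)) A)"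
    using fin A by (subst emeasure_weighted_sum) auto
  also have "\<dots> = (\<Sum>i\<in>I. \<Sum>k\<in>K.
      ennreal (w i * q i k) * emeasure (distr (\<nu> i k) borel (g i)) A)"
  proof (rule sum.cong[OF refl])
    fix i assume i: "i \<in> I"
    have meas: "g i \<in> measurable \<rho> borel" if "sets \<rho> = sets borel" for \<rho>
      using g[OF i] measurable_cong_sets[OF that refl] by blast
    have pre: "g i -` A \<in> sets borel"
      using measurable_sets[OF g[OF i] A] by simp
    have space: "space \<rho> = UNIV" if "sets \<rho> = sets (borel :: 'a measure)" for \<rho>
      using sets_eq_imp_space_eq[OF that] by simp
    have "emeasure (distr (weighted_sum K (q i) (\<nu> i)) borel (g i)) A
        = emeasure (weighted_sum K (q i) (\<nu> i)) (g i -` A)"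
      using meas A by (subst emeasure_distr) (auto simp: space)
    also have "\<dots> = (\<Sum>k\<in>K. ennreal (q i k) * emeasure (\<nu> i k) (g i -` A))"
      using fin sets[OF i] pre by (rule_tac emeasure_weighted_sum) auto
    also have "\<dots> = (\<Sum>k\<in>K. ennreal (q i k) * emeasure (distr (\<nu> i k) borel (g i)) A)"
      using meas A sets[OF i] by (intro sum.cong refl) (simp add: emeasure_distr space)
    \<comment> \<open>\<open>ennreal\<close> sends negative numbers to 0, so it fails to be
      multiplicative when both factors are negative; \<open>w i\<close> \<ge> 0 rules this
      out.\<close>
    finally show "ennreal (w i) * emeasure (distr (weighted_sum K (q i) (\<nu> i)) borel (g i)) A
        = (\<Sum>k\<in>K. ennreal (w i * q i k) * emeasure (distr (\<nu> i k) borel (g i)) A)"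
      using w[OF i] by (simp add: sum_distrib_left ennreal_mult' mult.assoc)
  qed
  also have "\<dots> = (\<Sum>(i, k)\<in>I \<times> K.
      ennreal (w i * q i k) * emeasure (distr (\<nu> i k) borel (g i)) A)"
    by (rule sum.cartesian_product)
  also have "\<dots> = emeasure ?R A"
    using fin A by (subst emeasure_weighted_sum) (auto simp: case_prod_unfold)
  finally show "emeasure ?L A = emeasure ?R A" .
qed simp

text \<open>The complement is the union of all open null sets. On a compact space this makes every
  support compact.\<close>

lemma closed_measure_support: "closed (measure_support \<mu>)"
proof -
  have "- measure_support \<mu> = \<Union>{U. open U \<and> emeasure \<mu> U = 0}"
    by (auto simp: measure_support_def zero_less_iff_neq_zero)
  then show ?thesis by (simp add: closed_def open_Union)
qed

text \<open>Closedness of the range makes its complement an open set; the image measure vanishes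
  there, so no point of that complement can be in the support.\<close>

lemma measure_support_distr_subset:
  assumes "g \<in> measurable \<mu> borel" "closed (range g)"
  shows "measure_support (distr \<mu> borel g) \<subseteq> range g"
proof
  fix x assume x: "x \<in> measure_support (distr \<mu> borel g)"
  have "emeasure (distr \<mu> borel g) (- range g) = emeasure \<mu> (g -` (- range g) \<inter> space \<mu>)"
    using assms by (intro emeasure_distr) auto
  also have "g -` (- range g) \<inter> space \<mu> = {}" by auto
  finally have "emeasure (distr \<mu> borel g) (- range g) = 0" by simp
  with x assms(2) show "x \<in> range g"
    by (force simp: measure_support_def)
qed

lemma diameter_range_lipschitz_le:
  fixes g :: "'a::metric_space \<Rightarrow> 'b::metric_space"
  assumes "bounded (UNIV :: 'a set)" "c-lipschitz_on UNIV g" "S \<subseteq> range g"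
  shows "diameter S \<le> c * diameter (UNIV :: 'a set)"
proof -
  have c: "0 \<le> c" using assms(2) by (rule lipschitz_on_nonneg)
  have "dist x y \<le> c * diameter (UNIV :: 'a set)" if "x \<in> S" "y \<in> S" for x y
  proof -
    from that obtain x' y' where "x = g x'" "y = g y'" using assms(3) by blast
    then have "dist x y \<le> c * dist x' y'" using lipschitz_onD[OF assms(2)] by simp
    also have "\<dots> \<le> c * diameter (UNIV :: 'a set)"
      using c assms(1) by (intro mult_left_mono diameter_bounded_bound) auto
    finally show ?thesis .
  qed
  \<comment> \<open>For empty \<open>S\<close> the diameter is 0 by definition, and the bound then
    rests on the right-hand side being nonnegative.\<close>
  then show ?thesis
    using c assms(1) by (auto simp: diameter_def[of S] diameter_ge_0 intro!: cSUP_least)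
qed

text \<open>Each element of \<open>H\<close> has a preimage in \<open>H\<close> under some map of
  the IFS, so the expansion can be continued to any depth \<open>k\<close>. The tuple \<omega>
  varies with \<open>k\<close>, but all terms share it; hence at most \<open>V\<close> distinct
  measures occur, however large \<open>r\<close> gets.\<close>

lemma attractor_component_superposition:
  fixes f :: "nat \<Rightarrow> nat \<Rightarrow> 'a::metric_space \<Rightarrow> 'a"
  assumes H: "H \<subseteq> prob_tuples V"
      "H \<subseteq> (\<Union>\<phi>\<in>superIFS_map M V f p ` superIFS_indices M N V. \<phi> ` H)"
    and lip: "\<And>n m. n \<in> {1..N} \<Longrightarrow> m \<in> {1..M} \<Longrightarrow> l-lipschitz_on UNIV (f n m)"
    and p: "\<And>n m. n \<in> {1..N} \<Longrightarrow> m \<in> {1..M} \<Longrightarrow> p n m \<ge> 0"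
    and \<nu>: "\<nu> \<in> H" "v \<in> {1..V}"
  shows "\<exists>\<omega>\<in>H. \<exists>(r :: nat) g w i.
      (\<forall>j\<in>{1..r}. (l ^ k)-lipschitz_on UNIV (g j) \<and> w j \<ge> 0 \<and> i j \<in> {1..V}) \<and>
      \<nu> v = weighted_sum {1..r} w (\<lambda>j. distr (\<omega> (i j)) borel (g j))"
proof (induction k)
  case 0
  have "sets (\<nu> v) = sets borel"
    using \<nu> H(1) by (auto simp: prob_tuples_def borel_probs_def PiE_iff)
  \<comment> \<open>At depth 0 there is one term, with weight 1 and the identity, which is Lipschitz
    with constant \<open>l ^ 0\<close>. Pushing forward to \<open>borel\<close> along the identity
    gives back \<open>\<nu> v\<close> because its measurable sets are the Borel sets.\<close>
  then have "\<nu> v = weighted_sum {1..1::nat} (\<lambda>_. 1) (\<lambda>_. distr (\<nu> v) borel (\<lambda>x. x))"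
    using weighted_sum_singleton[of "\<lambda>_. distr (\<nu> v) borel (\<lambda>x. x)" "1::nat" "\<lambda>_. 1"]
    by (simp add: distr_id2)
  moreover have "1-lipschitz_on UNIV (\<lambda>x :: 'a. x)" by (simp add: lipschitz_on_def)
  ultimately show ?case using \<nu>
    by (intro bexI[of _ \<nu>] exI[of _ 1] exI[of _ "\<lambda>_ x. x"] exI[of _ "\<lambda>_. 1"] exI[of _ "\<lambda>_. v"])
      simp_all
next
  case (Suc k)
  then obtain \<omega> and r :: nat and g w i where \<omega>: "\<omega> \<in> H"
    and g: "\<And>j. j \<in> {1..r} \<Longrightarrow> (l ^ k)-lipschitz_on UNIV (g j)"
    and w: "\<And>j. j \<in> {1..r} \<Longrightarrow> w j \<ge> 0"
    and i: "\<And>j. j \<in> {1..r} \<Longrightarrow> i j \<in> {1..V}"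
    and eq: "\<nu> v = weighted_sum {1..r} w (\<lambda>j. distr (\<omega> (i j)) borel (g j))"
    by blast
  \<comment> \<open>One map is undone on the whole tuple rather than term by term: a single
    \<open>a\<close> and a single \<open>\<omega>'\<close> serve all components of \<omega>, which
    keeps the number of distinct measures at \<open>V\<close>.\<close>
  obtain a \<omega>' where a: "a \<in> superIFS_indices M N V" and \<omega>': "\<omega>' \<in> H"
    and \<omega>_eq: "\<omega> = superIFS_map M V f p a \<omega>'"
    using H(2) \<omega> by blast
  \<comment> \<open>Term \<open>j\<close> uses component \<open>i j\<close> of \<omega>, which is
    built from the maps of the IFS numbered \<open>n j\<close> and the components
    \<open>u j m\<close> of \<open>\<omega>'\<close>.\<close>
  define n where "n j = fst (a (i j))" for j
  define u where "u j m = snd (a (i j)) m" for j m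
  have n: "n j \<in> {1..N}" if "j \<in> {1..r}" for j
    using a i[OF that] unfolding superIFS_indices_def n_def by (force simp: PiE_iff)
  have u: "u j m \<in> {1..V}" if "j \<in> {1..r}" "m \<in> {1..M}" for j m
    using a i[OF that(1)] that(2) unfolding superIFS_indices_def u_def
    by (metis PiE_mem mem_Times_iff)
  have sets: "sets (\<omega>' t) = sets borel" if "t \<in> {1..V}" for t
    using that \<omega>' H(1) by (auto simp: prob_tuples_def borel_probs_def PiE_iff)
  have meas: "h \<in> borel_measurable borel" if "c-lipschitz_on UNIV h" for c and h :: "'a \<Rightarrow> 'a"
    using that lipschitz_on_continuous_on borel_measurable_continuous_onI by blast
  \<comment> \<open>Each old term splits into \<open>M\<close> new ones. The newly exposed map acts
    first, before the composition already collected in \<open>g j\<close>, and contributes one more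
    factor \<open>l\<close>.\<close>
  let ?G = "\<lambda>(j, m). g j \<circ> f (n j) m"
  let ?w = "\<lambda>(j, m). w j * p (n j) m"
  let ?i = "\<lambda>(j, m). u j m"
  let ?J = "{1..r} \<times> {1..M}"
  have "\<nu> v = weighted_sum {1..r} w (\<lambda>j. distr
      (weighted_sum {1..M} (p (n j)) (\<lambda>m. distr (\<omega>' (u j m)) borel (f (n j) m))) borel (g j))"
    unfolding eq using i
    by (intro weighted_sum_cong refl) (simp add: \<omega>_eq superIFS_map_def n_def u_def)
  also have "\<dots> = weighted_sum ?J ?w
      (\<lambda>(j, m). distr (distr (\<omega>' (u j m)) borel (f (n j) m)) borel (g j))"
    using w g meas by (intro weighted_sum_distr_weighted_sum) auto
  also have "\<dots> = weighted_sum ?J ?w (\<lambda>x. distr (\<omega>' (?i x)) borel (?G x))"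
  proof (intro weighted_sum_cong refl)
    fix x assume "x \<in> ?J"
    then obtain j m where x: "x = (j, m)" and jm: "j \<in> {1..r}" "m \<in> {1..M}" by (rule SigmaE)
    have "f (n j) m \<in> measurable (\<omega>' (u j m)) borel"
      using meas[OF lip[OF n[OF jm(1)] jm(2)]] measurable_cong_sets[OF sets[OF u[OF jm]] refl]
      by blast
    then show "(case x of (j, m) \<Rightarrow> distr (distr (\<omega>' (u j m)) borel (f (n j) m)) borel (g j))
        = distr (\<omega>' (?i x)) borel (?G x)"
      using meas[OF g[OF jm(1)]] by (simp add: x distr_distr)
  qed
  finally have eq': "\<nu> v = weighted_sum ?J ?w (\<lambda>x. distr (\<omega>' (?i x)) borel (?G x))" .
  have props: "(l ^ Suc k)-lipschitz_on UNIV (?G x) \<and> ?w x \<ge> 0 \<and> ?i x \<in> {1..V}"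
    if xJ: "x \<in> ?J" for x
  proof -
    obtain j m where x: "x = (j, m)" and jm: "j \<in> {1..r}" "m \<in> {1..M}"
      using xJ by (rule SigmaE)
    have "(l ^ k * l)-lipschitz_on UNIV (g j \<circ> f (n j) m)"
      using lip[OF n[OF jm(1)] jm(2)] g[OF jm(1)]
      by (intro lipschitz_on_compose) (auto intro: lipschitz_on_subset)
    then show ?thesis
      using u[OF jm] w[OF jm(1)] p[OF n[OF jm(1)] jm(2)] by (simp add: x mult.commute)
  qed
  \<comment> \<open>The pairs are renumbered by an initial segment of the positive integers, as the
    claim requires.\<close>
  have "finite ?J" by simp
  then obtain h where h: "bij_betw h {1..card ?J} ?J"
    using ex_bij_betw_nat_finite_1 by blast
  have hJ: "h j \<in> ?J" if "j \<in> {1..card ?J}" for j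
    using h that by (rule bij_betw_apply)
  show ?case
  proof (intro bexI[of _ \<omega>'] exI conjI ballI)
    show "\<nu> v = weighted_sum {1..card ?J} (\<lambda>j. ?w (h j))
        (\<lambda>j. distr (\<omega>' (?i (h j))) borel (?G (h j)))"
      unfolding eq' by (rule weighted_sum_reindex[OF h])
  qed (use props hJ \<omega>' in blast)+
qed

theorem theorem23:
  fixes M N V :: nat
    and l \<epsilon> :: real
    and f :: "nat \<Rightarrow> nat \<Rightarrow> 'a::metric_space \<Rightarrow> 'a"
    and p :: "nat \<Rightarrow> nat \<Rightarrow> real"
    and H :: "(nat \<Rightarrow> 'a measure) set"
    and \<mu> :: "'a measure"
  assumes "compact (UNIV :: 'a set)"
    and "M > 0" and "N > 0" and "V > 0"
    and "0 \<le> l" and "l < 1"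
    and "\<And>n m. n \<in> {1..N} \<Longrightarrow> m \<in> {1..M} \<Longrightarrow> l-lipschitz_on UNIV (f n m)"
    and "\<And>n m. n \<in> {1..N} \<Longrightarrow> m \<in> {1..M} \<Longrightarrow> p n m \<ge> 0"
    and "\<And>n. n \<in> {1..N} \<Longrightarrow> (\<Sum>m\<in>{1..M}. p n m) = 1"
    and "is_set_attractor (prob_tuples V) (MK_dist_max V)
           (superIFS_map M V f p ` superIFS_indices M N V) H"
    and "\<mu> \<in> (\<lambda>\<nu>. \<nu> 1) ` H"
    and "\<epsilon> > 0"
  shows "\<exists>(\<omega> :: nat \<Rightarrow> 'a measure) (r :: nat) (g :: nat \<Rightarrow> 'a \<Rightarrow> 'a) (w :: nat \<Rightarrow> real) (i :: nat \<Rightarrow> nat).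
           (\<forall>v\<in>{1..V}. \<omega> v \<in> borel_probs \<and> compact (measure_support (\<omega> v))) \<and>
           (\<forall>j\<in>{1..r}. continuous_on UNIV (g j) \<and> w j \<ge> 0 \<and> i j \<in> {1..V} \<and>
              diameter (measure_support (distr (\<omega> (i j)) borel (g j))) \<le> \<epsilon>) \<and>
           \<mu> = weighted_sum {1..r} w (\<lambda>j. distr (\<omega> (i j)) borel (g j))"
proof -
  let ?D = "diameter (UNIV :: 'a set)"
  have bdd: "bounded (UNIV :: 'a set)" using assms(1) by (rule compact_imp_bounded)
  \<comment> \<open>The depth \<open>k\<close> is fixed before expanding, so that
    \<open>l ^ k * ?D\<close> will bound the diameters of the supports. Taking the limit of the
    product also covers \<open>?D = 0\<close>, with no division by \<open>?D\<close>.\<close>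
  have "(\<lambda>k. l ^ k * ?D) \<longlonglongrightarrow> 0 * ?D"
    using assms(5,6) by (intro tendsto_intros LIMSEQ_realpow_zero)
  then have "\<forall>\<^sub>F k in sequentially. l ^ k * ?D < \<epsilon>"
    using \<open>\<epsilon> > 0\<close> by (intro order_tendstoD) auto
  then obtain k where k: "l ^ k * ?D < \<epsilon>"
    unfolding eventually_sequentially by blast
  have H: "H \<subseteq> prob_tuples V"
      "H \<subseteq> (\<Union>\<phi>\<in>superIFS_map M V f p ` superIFS_indices M N V. \<phi> ` H)"
    using assms(10) unfolding is_set_attractor_def by blast+
  obtain \<nu> where \<nu>: "\<nu> \<in> H" "\<mu> = \<nu> 1" using assms(11) by blast
  have "1 \<in> {1..V}" using \<open>V > 0\<close> by simp
  from attractor_component_superposition[OF H assms(7,8) \<nu>(1) this, of k]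
  obtain \<omega> and r :: nat and g w i where \<omega>: "\<omega> \<in> H"
    and g: "\<And>j. j \<in> {1..r} \<Longrightarrow> (l ^ k)-lipschitz_on UNIV (g j) \<and> w j \<ge> 0 \<and> i j \<in> {1..V}"
    and eq: "\<mu> = weighted_sum {1..r} w (\<lambda>j. distr (\<omega> (i j)) borel (g j))"
    unfolding \<nu>(2) by blast
  have \<omega>p: "\<omega> v \<in> borel_probs" if "v \<in> {1..V}" for v
    using \<omega> H(1) that by (auto simp: prob_tuples_def PiE_iff)
  have "compact (measure_support (\<omega> v))" for v
    using compact_Int_closed[OF assms(1) closed_measure_support] by simp
  moreover have "continuous_on UNIV (g j)"
    and "diameter (measure_support (distr (\<omega> (i j)) borel (g j))) \<le> \<epsilon>"
    if j: "j \<in> {1..r}" for j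
  proof -
    have lip: "(l ^ k)-lipschitz_on UNIV (g j)" using g[OF j] by blast
    show cont: "continuous_on UNIV (g j)" using lip by (rule lipschitz_on_continuous_on)
    have "sets (\<omega> (i j)) = sets borel" using g[OF j] \<omega>p by (auto simp: borel_probs_def)
    then have "g j \<in> measurable (\<omega> (i j)) borel"
      using borel_measurable_continuous_onI[OF cont] measurable_cong_sets by blast
    \<comment> \<open>Here compactness of the space is used a second time: the range is a compact
      image, hence closed, so the support cannot leave it.\<close>
    moreover have "closed (range (g j))"
      using compact_continuous_image[OF cont assms(1)] by (rule compact_imp_closed)
    ultimately have "measure_support (distr (\<omega> (i j)) borel (g j)) \<subseteq> range (g j)"
      by (rule measure_support_distr_subset)
    from diameter_range_lipschitz_le[OF bdd lip this] k
    show "diameter (measure_support (distr (\<omega> (i j)) borel (g j))) \<le> \<epsilon>" by linarith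
  qed
  ultimately show ?thesis using \<omega>p g eq by blast
qed

end
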